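(* Let $N$ and $k$ be integers with $1\le k\le N$, let $\epsilon>0$ be a real number (the error threshold), and let $\vec{x}_1,\vec{x}_2\in\mathbb{R}^N$ be fixed vectors. Let $U$ be a random element of the unitary group $\mathbb{U}(N)$ sampled from the Haar probability measure $\mu_H$. Let $\Pi$ be the $k\times N$ matrix obtained by taking any fixed choice of $k$ rows of $U$ and multiplying the result by $\sqrt{N/k}$. Then, with probability at least $$1-\frac{N-k}{4kN\epsilon^2}$$ over the choice of $U$, one has $$(1-\epsilon)\,|\vec{x}_1-\vec{x}_2|_2\;\le\;|\Pi(\vec{x}_1-\vec{x}_2)|_2\;\le\;(1+\epsilon)\,|\vec{x}_1-\vec{x}_2|_2 .$$
   Context: $\mathbb{U}(N)$ is the group of $N\times N$ complex unitary matrices, and $\mu_H$ is its Haar probability measure. $|\cdot|_2$ denotes the $\ell_2$ (Euclidean/Hermitian) norm of a vector. The $k$ row indices are chosen independently of $U$. *)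

theory Defs
  imports "HOL-Probability.Probability"
begin

definition conj_transpose :: "complex^'n^'m \<Rightarrow> complex^'m^'n"
  where "conj_transpose A = (\<chi> i j. cnj (A $ j $ i))"

definition unitary_group :: "(complex^'n^'n) set"
  where "unitary_group =
    {U. conj_transpose U ** U = mat 1 \<and> U ** conj_transpose U = mat 1}"

text \<open>
  The unitary group is compact, so a left-invariant Borel probability measure on it exists, is
  unique, and is automatically right-invariant and regular; only left invariance is demanded here.
\<close>

definition haar_prob_measure :: "(complex^'n^'n) measure \<Rightarrow> bool"
  where "haar_prob_measure \<mu> \<longleftrightarrow>
    prob_space \<mu> \<and>
    space \<mu> = unitary_group \<and>
    sets \<mu> = sets (restrict_space borel unitary_group) \<and>
    (\<forall>V \<in> unitary_group. \<forall>A \<in> sets \<mu>.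
       emeasure \<mu> ((\<lambda>U. V ** U) ` A) = emeasure \<mu> A)"

text \<open>
  The chosen rows are given by a map \<open>r\<close> (to be injective) from the row indices of the
  \<open>k \<times> N\<close> matrix to those of \<open>U\<close>, where \<open>k = CARD('k)\<close> and \<open>N = CARD('n)\<close>.
\<close>

definition scaled_rows :: "('k \<Rightarrow> 'n) \<Rightarrow> complex^'n^'n \<Rightarrow> complex^'n^'k"
  where "scaled_rows r U = sqrt (real CARD('n) / real CARD('k)) *\<^sub>R (\<chi> i. row (r i) U)"

definition complex_vec :: "real^'n \<Rightarrow> complex^'n"
  where "complex_vec x = (\<chi> i. complex_of_real (x $ i))"

end

(* The deviation of Z = |Pi x| from R = |x| is controlled by Markov's inequality for (Z - R)^2, whose mean is
   2 R (R - E Z) because E Z^2 = R^2. (Chebyshev's inequality for Z^2 would lose the constant 1/4.)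

   To find E Z, let a be a complex standard Gaussian vector supported on a set I of coordinates. Invariance of
   the Haar measure makes the mean of |Re <a, U x>| over U equal to C |a| with C independent of a. Taking
   the mean over a as well, in both orders, shows that the mean over U of the norm of the I-part of U x is
   proportional to E|a|, hence to g(|I|) with g(n) = Gamma(n + 1/2) / Gamma(n). Therefore
   E Z = R sqrt(N/k) g(k) / g(N), and since g(n+1) / g(n) = (n + 1/2) / n, a telescoping product
   gives E Z >= R (1 - (1/k - 1/N) / 8). *)

theory Submission
  imports Defs
begin

subsection \<open>Quotients of Gamma values at half-integer distance\<close>

lemma Gamma_half_quotient_Suc:
  assumes "0 < n"
  shows "Gamma (real (Suc n) + 1 / 2) / Gamma (real (Suc n)) =
    (real n + 1 / 2) / real n * (Gamma (real n + 1 / 2) / Gamma (real n))"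
proof -
  have "Gamma (real (Suc n) + 1 / 2) = (real n + 1 / 2) * Gamma (real n + 1 / 2)"
    using Gamma_plus1[of "real n + 1 / 2"] assms by (simp add: algebra_simps nonpos_Ints_def)
  moreover have "Gamma (real (Suc n)) = real n * Gamma (real n)"
    using Gamma_plus1[of "real n"] assms by (simp add: algebra_simps nonpos_Ints_def)
  ultimately show ?thesis by simp
qed

text \<open>This bounds one factor of the telescoping product: for
  \<open>g n = Gamma (n + 1/2) / Gamma n\<close>, passing from \<open>n\<close> to
  \<open>n + 1\<close> multiplies \<open>g n / sqrt n\<close> by
  \<open>(n + 1/2) / sqrt (n * (n + 1))\<close>.\<close>

lemma sqrt_quotient_lower_bound:
  fixes x :: real
  assumes "1 \<le> x"
  shows "(1 - (1 / x - 1 / (x + 1)) / 8) * (x + 1 / 2) \<le> sqrt (x * (x + 1))"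
proof (rule real_le_rsqrt)
  \<comment> \<open>In terms of \<open>m\<close>, \<open>(x + 1/2)^2 = (m + 1) / 4\<close> and
    \<open>1/x - 1/(x + 1) = 4 / m\<close>, so the squared claim becomes a rational inequality in
    \<open>m\<close> alone.\<close>
  define m where "m = 4 * x * (x + 1)"
  have m: "m \<ge> 8" unfolding m_def using assms mult_mono[of 1 x 2 "x + 1"] by simp
  have "(1 - 1 / (2 * m))\<^sup>2 * (m + 1) = m - (3 * m - 1) / (4 * m\<^sup>2)"
    using m by (simp add: field_simps power2_eq_square)
  also have "\<dots> \<le> m" using m by simp
  finally have *: "(1 - 1 / (2 * m))\<^sup>2 * (m + 1) \<le> m" .
  have "1 / x - 1 / (x + 1) = 4 / m"
    using assms by (simp add: m_def divide_simps)
  then have "((1 - (1 / x - 1 / (x + 1)) / 8) * (x + 1 / 2))\<^sup>2 = (1 - 1 / (2 * m))\<^sup>2 * (m + 1) / 4"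
    by (simp add: power_mult_distrib) (simp add: m_def power2_eq_square field_simps)
  also have "\<dots> \<le> x * (x + 1)"
    using * by (simp add: m_def)
  finally show "((1 - (1 / x - 1 / (x + 1)) / 8) * (x + 1 / 2))\<^sup>2 \<le> x * (x + 1)" .
qed

text \<open>Induction on \<open>N\<close> multiplies the one-step bounds. Their losses add, because
  \<open>(1 - A) * (1 - B) \<ge> 1 - A - B\<close>, and the differences
  \<open>1/n - 1/(n + 1)\<close> telescope to \<open>1/k - 1/N\<close>.\<close>

lemma Gamma_half_quotient_ratio:
  assumes "0 < k" "k \<le> N"
  defines "g \<equiv> \<lambda>n. Gamma (real n + 1 / 2) / Gamma (real n)"
  shows "(1 - (1 / real k - 1 / real N) / 8) * (g N / sqrt N) \<le> g k / sqrt k"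
  using \<open>k \<le> N\<close>
proof (induction N rule: dec_induct)
  case base
  then show ?case by simp
next
  case (step n)
  have n: "1 \<le> real n" using step assms by linarith
  define A where "A = (1 / real k - 1 / real n) / 8"
  define B where "B = (1 / real n - 1 / real (Suc n)) / 8"
  \<comment> \<open>\<open>A \<le> 1\<close> lets the one-step bound be multiplied by
    \<open>1 - A\<close>; the signs of \<open>A\<close> and \<open>B\<close> allow the term
    \<open>A * B\<close> to be dropped.\<close>
  have A: "0 \<le> A" "A \<le> 1"
  proof -
    have *: "1 / real n \<le> 1 / real k" "1 / real k \<le> 1" "0 \<le> 1 / real n"
      using step assms by (auto simp: field_simps)
    show "0 \<le> A" unfolding A_def using * by simp
    have "(p - q) / 8 \<le> 1" if "p \<le> 1" "0 \<le> q" for p q :: real using that by simp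
    then show "A \<le> 1" unfolding A_def using * by blast
  qed
  have B: "0 \<le> B" unfolding B_def using n by (simp add: field_simps)
  have pos: "0 < g n" "0 < g (Suc n)"
    unfolding g_def using n by (auto intro!: divide_pos_pos Gamma_real_pos)
  have "(1 - B) * (real n + 1 / 2) \<le> sqrt (real n) * sqrt (real (Suc n))"
    using sqrt_quotient_lower_bound[OF n] by (simp add: B_def add.commute real_sqrt_mult)
  then have "(1 - B) * (g (Suc n) / sqrt (Suc n)) \<le> g n / sqrt n"
  proof -
    assume *: "(1 - B) * (real n + 1 / 2) \<le> sqrt (real n) * sqrt (real (Suc n))"
    have "(1 - B) * (g (Suc n) / sqrt (Suc n)) =
        ((1 - B) * (real n + 1 / 2)) * (g n / (real n * sqrt (Suc n)))"
      using Gamma_half_quotient_Suc[of n] n unfolding g_def by (simp add: ac_simps)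
    also have "\<dots> \<le> (sqrt (real n) * sqrt (real (Suc n))) * (g n / (real n * sqrt (Suc n)))"
      using * pos n by (intro mult_right_mono) auto
    also have "\<dots> = g n / sqrt n"
      using n by (simp add: field_simps)
    finally show ?thesis .
  qed
  then have "(1 - A) * ((1 - B) * (g (Suc n) / sqrt (Suc n))) \<le> (1 - A) * (g n / sqrt n)"
    using A by (intro mult_left_mono) auto
  also have "\<dots> \<le> g k / sqrt k" using step.IH by (simp add: A_def)
  finally have "(1 - A) * (1 - B) * (g (Suc n) / sqrt (Suc n)) \<le> g k / sqrt k" by simp
  moreover have "(1 - A - B) * (g (Suc n) / sqrt (Suc n)) \<le> (1 - A) * (1 - B) * (g (Suc n) / sqrt (Suc n))"
    using A B pos by (intro mult_right_mono) (auto simp: algebra_simps)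
  moreover have "1 - A - B = 1 - (1 / real k - 1 / real (Suc n)) / 8"
    by (simp add: A_def B_def diff_divide_distrib)
  ultimately show ?case by (metis order_trans)
qed

subsection \<open>Unitary matrices\<close>

lemma unitary_group_mult:
  assumes "U \<in> unitary_group" "V \<in> unitary_group"
  shows "U ** V \<in> unitary_group"
proof -
  have ct: "conj_transpose (U ** V) = conj_transpose V ** conj_transpose U"
    by (simp add: conj_transpose_def matrix_matrix_mult_def vec_eq_iff mult.commute)
  have "conj_transpose V ** conj_transpose U ** (U ** V) =
      conj_transpose V ** (conj_transpose U ** U) ** V"
    by (simp add: matrix_mul_assoc)
  moreover have "U ** V ** (conj_transpose V ** conj_transpose U) =
      U ** (V ** conj_transpose V) ** conj_transpose U"
    by (simp add: matrix_mul_assoc)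
  ultimately show ?thesis
    using assms by (simp add: unitary_group_def ct matrix_mul_rid)
qed

lemma unitary_group_conj_transpose:
  "U \<in> unitary_group \<Longrightarrow> conj_transpose U \<in> unitary_group"
  by (simp add: unitary_group_def conj_transpose_def vec_eq_iff)

lemma inner_vec_eq_Re:
  fixes a y :: "complex^'n"
  shows "a \<bullet> y = Re (\<Sum>i\<in>UNIV. cnj (a $ i) * y $ i)"
  by (simp add: inner_vec_def inner_complex_def)

text \<open>The real inner product of complex vectors is the real part of the Hermitian one, so its
  adjoint is the conjugate transpose. This moves a unitary factor from \<open>U *v d\<close> onto
  the test vector \<open>a\<close>.\<close>

lemma inner_matrix_vector_conj_transpose:
  fixes A :: "complex^'n^'m"
  shows "a \<bullet> (A *v y) = (conj_transpose A *v a) \<bullet> y"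
proof -
  have "(\<Sum>i\<in>UNIV. cnj (a $ i) * (A *v y) $ i) = (\<Sum>i\<in>UNIV. \<Sum>j\<in>UNIV. cnj (a $ i) * A $ i $ j * y $ j)"
    by (simp add: matrix_vector_mult_def sum_distrib_left mult.assoc)
  also have "\<dots> = (\<Sum>j\<in>UNIV. \<Sum>i\<in>UNIV. cnj (a $ i) * A $ i $ j * y $ j)"
    by (rule sum.swap)
  also have "\<dots> = (\<Sum>j\<in>UNIV. cnj ((conj_transpose A *v a) $ j) * y $ j)"
    by (simp add: matrix_vector_mult_def conj_transpose_def sum_distrib_right sum_distrib_left ac_simps)
  finally show ?thesis by (simp add: inner_vec_eq_Re)
qed

lemma norm_unitary_mult:
  assumes "U \<in> unitary_group"
  shows "norm (U *v y) = norm y"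
proof -
  have "(U *v y) \<bullet> (U *v y) = (conj_transpose U *v (U *v y)) \<bullet> y"
    by (rule inner_matrix_vector_conj_transpose)
  also have "conj_transpose U *v (U *v y) = y"
    using assms by (simp add: matrix_vector_mul_assoc unitary_group_def)
  finally show ?thesis by (simp add: norm_eq_sqrt_inner)
qed

lemma norm_vec_complex_sum: "complex_of_real ((norm (v :: complex^'n))\<^sup>2) = (\<Sum>i\<in>UNIV. v $ i * cnj (v $ i))"
  by (simp add: norm_vec_def L2_set_def sum_nonneg flip: complex_norm_square)

text \<open>The unitary is \<open>I - c v v\<^sup>*\<close> with \<open>v = a - b\<close> and \<open>c = 1 / (v\<^sup>* a)\<close>; it is unitary because
  \<open>1 / c + cnj (1 / c) = |v|\<^sup>2\<close> when \<open>|a| = |b|\<close>.\<close>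
lemma unitary_group_transitive:
  fixes a b :: "complex^'n"
  assumes "norm a = norm b"
  obtains V where "V \<in> unitary_group" "V *v a = b"
proof (cases "a = b")
  case True
  have "(mat 1 :: complex^'n^'n) \<in> unitary_group"
  proof -
    have "conj_transpose (mat 1 :: complex^'n^'n) = mat 1"
      by (simp add: conj_transpose_def mat_def vec_eq_iff)
    then show ?thesis by (simp add: unitary_group_def)
  qed
  then show ?thesis using True that[of "mat 1"] by simp
next
  case False
  define v where "v = a - b"
  define p where "p = (\<Sum>i\<in>UNIV. cnj (v $ i) * a $ i)"
  define s where "s = (\<Sum>i\<in>UNIV. v $ i * cnj (v $ i))"
  define c where "c = 1 / p"
  have s: "s = complex_of_real ((norm v)\<^sup>2)" unfolding s_def by (simp only: norm_vec_complex_sum)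
  have sn0: "s \<noteq> 0" using False by (simp add: s v_def)
  have ab: "(\<Sum>i\<in>UNIV. a $ i * cnj (a $ i)) = (\<Sum>i\<in>UNIV. b $ i * cnj (b $ i))"
    using assms by (simp only: norm_vec_complex_sum [symmetric])
  \<comment> \<open>Here \<open>|a| = |b|\<close> enters: with \<open>v = a - b\<close> the left
    side is the difference of the squared norms.\<close>
  have "p + cnj p - s = (\<Sum>i\<in>UNIV. a $ i * cnj (a $ i)) - (\<Sum>i\<in>UNIV. b $ i * cnj (b $ i))"
    by (simp add: p_def s_def v_def sum.distrib [symmetric] sum_subtractf [symmetric] algebra_simps)
  then have ps: "p + cnj p = s" using ab by simp
  have p0: "p \<noteq> 0" using ps sn0 by auto
  have cc: "c + cnj c = c * cnj c * s"
    using p0 by (simp add: c_def ps [symmetric] field_simps)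
  define V :: "complex^'n^'n" where "V = (\<chi> i j. (if i = j then 1 else 0) - c * v $ i * cnj (v $ j))"
  define W :: "complex^'n^'n" where "W = (\<chi> i j. (if i = j then 1 else 0) - cnj c * v $ i * cnj (v $ j))"
  have W: "conj_transpose V = W"
    by (simp add: V_def W_def conj_transpose_def vec_eq_iff)
  \<comment> \<open>The rank-one terms of the product have total coefficient
    \<open>x * y * s - (x + y)\<close>. Free \<open>x\<close> and \<open>y\<close> cover both orders
    of \<open>V\<close> and \<open>W\<close>.\<close>
  have prod: "(\<Sum>k\<in>UNIV. ((if i = k then 1 else 0) - x * v $ i * cnj (v $ k)) *
      ((if k = j then 1 else 0) - y * v $ k * cnj (v $ j))) = (if i = j then 1 else 0)"
    if xy: "x + y = x * y * s" for x y i j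
  proof -
    have "(\<Sum>k\<in>UNIV. ((if i = k then 1 else 0) - x * v $ i * cnj (v $ k)) *
      ((if k = j then 1 else 0) - y * v $ k * cnj (v $ j))) =
      (\<Sum>k\<in>UNIV. (if i = k then (if k = j then 1 else 0) else 0)
        - (if k = i then y * v $ k * cnj (v $ j) else 0)
        - (if k = j then x * v $ i * cnj (v $ k) else 0)
        + x * y * v $ i * cnj (v $ j) * (v $ k * cnj (v $ k)))"
      by (intro sum.cong) (auto simp: algebra_simps)
    also have "\<dots> = (if i = j then 1 else 0) - (x + y) * (v $ i * cnj (v $ j)) + x * y * v $ i * cnj (v $ j) * s"
      by (simp add: sum.distrib sum_subtractf sum_distrib_left [symmetric] s_def [symmetric])
        (simp add: algebra_simps)
    also have "\<dots> = (if i = j then 1 else 0)" by (simp add: xy algebra_simps)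
    finally show ?thesis .
  qed
  have "V ** W = mat 1"
    using prod[OF cc] by (simp add: V_def W_def matrix_matrix_mult_def mat_def vec_eq_iff)
  moreover have "W ** V = mat 1"
    using prod[of "cnj c" c] cc by (simp add: V_def W_def matrix_matrix_mult_def mat_def vec_eq_iff ac_simps)
  ultimately have "V \<in> unitary_group" by (simp add: unitary_group_def W)
  \<comment> \<open>By the choice of \<open>c\<close>, \<open>c * p = 1\<close>, whence
    \<open>V *v a = a - v = b\<close>.\<close>
  moreover have "V *v a = b"
  proof -
    have "(V *v a) $ i = a $ i - v $ i * (c * p)" for i
    proof -
      have "(V *v a) $ i = (\<Sum>j\<in>UNIV. (if j = i then a $ j else 0) - c * v $ i * (cnj (v $ j) * a $ j))"
        unfolding V_def matrix_vector_mult_def vec_lambda_beta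
        by (intro sum.cong) (auto simp: algebra_simps)
      also have "\<dots> = a $ i - c * v $ i * p"
        by (simp add: sum_subtractf sum_distrib_left [symmetric] p_def)
      finally show ?thesis by simp
    qed
    then show ?thesis using p0 by (simp add: vec_eq_iff c_def v_def)
  qed
  ultimately show ?thesis by (rule that)
qed

subsection \<open>Gaussian families\<close>

text \<open>A linear combination of independent standard normals is centred normal with deviation
  \<open>\<sigma>\<close>, the Euclidean norm of the coefficients, and its mean absolute value is
  \<open>\<sigma> * sqrt (2 / pi)\<close>.\<close>

lemma (in prob_space) nn_integral_abs_sum_indep_std_normal:
  fixes X :: "'i \<Rightarrow> 'a \<Rightarrow> real"
  assumes fin: "finite I" and ind: "indep_vars (\<lambda>_. borel) X I"
    and X: "\<And>i. i \<in> I \<Longrightarrow> distributed M lborel (X i) std_normal_density"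
  shows "(\<integral>\<^sup>+\<omega>. ennreal \<bar>\<Sum>i\<in>I. c i * X i \<omega>\<bar> \<partial>M) =
    ennreal (sqrt (2 / pi) * sqrt (\<Sum>i\<in>I. (c i)\<^sup>2))"
proof -
  \<comment> \<open>Zero coefficients are dropped, since each summand must be normal with positive
    deviation.\<close>
  define J where "J = {i\<in>I. c i \<noteq> 0}"
  have J: "finite J" "J \<subseteq> I" using fin by (auto simp: J_def)
  have sumJ: "(\<Sum>i\<in>I. c i * X i \<omega>) = (\<Sum>i\<in>J. c i * X i \<omega>)" for \<omega>
    using fin by (intro sum.mono_neutral_right) (auto simp: J_def)
  have sqJ: "(\<Sum>i\<in>I. (c i)\<^sup>2) = (\<Sum>i\<in>J. (c i)\<^sup>2)"
    using fin by (intro sum.mono_neutral_right) (auto simp: J_def)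
  show ?thesis
  proof (cases "J = {}")
    case True
    then show ?thesis by (simp add: sumJ sqJ)
  next
    case False
    define \<sigma> where "\<sigma> = sqrt (\<Sum>i\<in>J. (c i)\<^sup>2)"
    have \<sigma>: "0 < \<sigma>"
      unfolding \<sigma>_def using J False by (auto intro!: sum_pos simp: J_def)
    have "distributed M lborel (\<lambda>x. \<Sum>i\<in>J. c i * X i x)
        (normal_density (\<Sum>i\<in>J. 0) (sqrt (\<Sum>i\<in>J. \<bar>c i\<bar>\<^sup>2)))"
    proof (rule sum_indep_normal)
      show "indep_vars (\<lambda>i. borel) (\<lambda>i x. c i * X i x) J"
        using indep_vars_compose2[OF indep_vars_subset[OF ind J(2)], of "\<lambda>i x. c i * x" "\<lambda>_. borel"]
        by simp
      show "distributed M lborel (\<lambda>x. c i * X i x) (normal_density 0 \<bar>c i\<bar>)" if "i \<in> J" for i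
        using normal_density_affine[of "X i" 0 1 "c i" 0] X[of i] that by (auto simp: J_def)
    qed (use J False in \<open>auto simp: J_def\<close>)
    then have D: "distributed M lborel (\<lambda>x. \<Sum>i\<in>J. c i * X i x) (normal_density 0 \<sigma>)"
      by (simp add: \<sigma>_def)
    have "(\<integral>\<^sup>+\<omega>. ennreal \<bar>\<Sum>i\<in>J. c i * X i \<omega>\<bar> \<partial>M) =
        (\<integral>\<^sup>+x. ennreal (normal_density 0 \<sigma> x) * ennreal \<bar>x\<bar> \<partial>lborel)"
      using distributed_nn_integral[OF D, of "\<lambda>x. ennreal \<bar>x\<bar>"] by simp
    \<comment> \<open>The integrand takes the shape of an odd absolute moment of order
      \<open>2 * 0 + 1\<close> about mean \<open>0\<close>.\<close>
    also have "\<dots> = (\<integral>\<^sup>+x. ennreal (normal_density 0 \<sigma> x * \<bar>x - 0\<bar> ^ (2 * 0 + 1)) \<partial>lborel)"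
      by (simp add: ennreal_mult)
    also have "\<dots> = ennreal (\<sigma> * sqrt (2 / pi))"
      using normal_moment_abs_odd[OF \<sigma>, of 0 0]
      by (subst nn_integral_eq_integral) (auto simp: has_bochner_integral_iff)
    finally show ?thesis by (simp add: sumJ sqJ \<sigma>_def mult.commute)
  qed
qed

text \<open>The layer-cake identity \<open>exp (- q / 2) = exp (- a) + (\<integral>u=q/2..a. exp (- u))\<close> turns the Gaussian
  measure of the disc \<open>q \<le> 2 * a\<close> into areas of discs.\<close>
lemma nn_integral_gaussian_disc:
  fixes a :: real
  assumes "0 \<le> a"
  shows "(\<integral>\<^sup>+z. ennreal (exp (- (norm z)\<^sup>2 / 2) * indicator {z. (norm z)\<^sup>2 / 2 \<le> a} z)
      \<partial>(lborel :: (real \<times> real) measure)) = ennreal (2 * pi * (1 - exp (- a)))"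
    (is "?I = _")
proof -
  let ?L = "lborel :: (real \<times> real) measure"
  let ?q = "\<lambda>z :: real \<times> real. (norm z)\<^sup>2 / 2"
  \<comment> \<open>The disc has radius \<open>sqrt (2 * u)\<close>, hence area linear in
    \<open>u\<close>.\<close>
  have disc: "emeasure ?L {z. ?q z \<le> u} = ennreal (2 * pi * u)" if "0 \<le> u" for u
  proof -
    have "{z :: real \<times> real. ?q z \<le> u} = cball 0 (sqrt (2 * u))"
    proof -
      have "norm z \<le> sqrt (2 * u) \<longleftrightarrow> ?q z \<le> u" for z :: "real \<times> real"
        using real_sqrt_le_iff[of "(norm z)\<^sup>2" "2 * u"] by (simp del: real_sqrt_le_iff) (simp add: mult.commute)
      then show ?thesis by auto
    qed
    then show ?thesis
      using that emeasure_cball[of "sqrt (2 * u)" "0 :: real \<times> real"]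
      by (simp add: unit_ball_vol_2 algebra_simps)
  qed
  have weighted_disc: "ennreal (exp (- u)) * emeasure ?L {z. ?q z \<le> u} = ennreal (2 * pi * u * exp (- u))"
    if "0 \<le> u" for u
    unfolding disc[OF that] by (subst ennreal_mult'' [symmetric]) (simp_all add: that ac_simps)
  have "ennreal (exp (- ?q z) * indicator {z. ?q z \<le> a} z) =
      ennreal (exp (- a)) * indicator {z. ?q z \<le> a} z +
      (\<integral>\<^sup>+u. ennreal (exp (- u)) * indicator {0..a} u * indicator {z. ?q z \<le> u} z \<partial>lborel)" for z
  proof (cases "?q z \<le> a")
    case True
    have "(\<integral>\<^sup>+u. ennreal (exp (- u)) * indicator {0..a} u * indicator {z. ?q z \<le> u} z \<partial>lborel) =
        (\<integral>\<^sup>+u. ennreal (exp (- u)) * indicator {?q z..a} u \<partial>lborel)"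
      by (intro nn_integral_cong) (auto split: split_indicator intro: order_trans[of 0 "?q z"])
    also have "\<dots> = ennreal (- exp (- a) - - exp (- ?q z))"
      using True by (intro nn_integral_FTC_Icc) (auto intro!: derivative_eq_intros)
    finally show ?thesis
      using True by (simp add: ennreal_plus [symmetric] del: ennreal_plus)
  next
    case False
    then have "(\<integral>\<^sup>+u. ennreal (exp (- u)) * indicator {0..a} u * indicator {z. ?q z \<le> u} z \<partial>lborel) =
        (\<integral>\<^sup>+u. 0 \<partial>(lborel :: real measure))"
      by (intro nn_integral_cong) (auto split: split_indicator)
    then show ?thesis using False by simp
  qed
  then have "?I = (\<integral>\<^sup>+z. ennreal (exp (- a)) * indicator {z. ?q z \<le> a} z +
      (\<integral>\<^sup>+u. ennreal (exp (- u)) * indicator {0..a} u * indicator {z. ?q z \<le> u} z \<partial>lborel) \<partial>?L)"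
    by simp
  also have "\<dots> = ennreal (exp (- a)) * emeasure ?L {z. ?q z \<le> a} +
      (\<integral>\<^sup>+z. \<integral>\<^sup>+u. ennreal (exp (- u)) * indicator {0..a} u * indicator {z. ?q z \<le> u} z \<partial>lborel \<partial>?L)"
  proof -
    have [measurable]: "(\<lambda>(z, u). ennreal (exp (- u)) * indicator {0..a} u * indicator {z. ?q z \<le> u} z)
        \<in> borel_measurable (?L \<Otimes>\<^sub>M lborel)"
      unfolding indicator_def by measurable
    show ?thesis by (simp add: nn_integral_add nn_integral_cmult_indicator)
  qed
  also have "\<dots> = ennreal (2 * pi * a * exp (- a)) + ennreal (2 * pi * (1 - (a + 1) * exp (- a)))"
  proof -
    \<comment> \<open>Exchanging the integrals leaves the area of the disc at level
      \<open>u\<close>, weighted by \<open>exp (- u)\<close>.\<close>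
    have "(\<integral>\<^sup>+z. \<integral>\<^sup>+u. ennreal (exp (- u)) * indicator {0..a} u * indicator {z. ?q z \<le> u} z \<partial>lborel \<partial>?L) =
        (\<integral>\<^sup>+u. \<integral>\<^sup>+z. ennreal (exp (- u)) * indicator {0..a} u * indicator {z. ?q z \<le> u} z \<partial>?L \<partial>lborel)"
      by (rule lborel_pair.Fubini') (unfold indicator_def, measurable)
    also have "\<dots> = (\<integral>\<^sup>+u. ennreal (2 * pi * u * exp (- u)) * indicator {0..a} u \<partial>lborel)"
    proof (intro nn_integral_cong)
      fix u :: real
      have "(\<integral>\<^sup>+z. ennreal (exp (- u)) * indicator {0..a} u * indicator {z. ?q z \<le> u} z \<partial>?L) =
          ennreal (exp (- u)) * indicator {0..a} u * emeasure ?L {z. ?q z \<le> u}"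
        by (rule nn_integral_cmult_indicator) simp
      also have "\<dots> = ennreal (2 * pi * u * exp (- u)) * indicator {0..a} u"
      proof (cases "u \<in> {0..a}")
        case True
        then show ?thesis using weighted_disc[of u] by (simp only: indicator_simps mult_1_right atLeastAtMost_iff)
      qed simp
      finally show "(\<integral>\<^sup>+z. ennreal (exp (- u)) * indicator {0..a} u * indicator {z. ?q z \<le> u} z \<partial>?L) =
          ennreal (2 * pi * u * exp (- u)) * indicator {0..a} u" .
    qed
    \<comment> \<open>The primitive of \<open>2 * pi * u * exp (- u)\<close> is
      \<open>- (2 * pi * (u + 1) * exp (- u))\<close>.\<close>
    also have "\<dots> = ennreal (- (2 * pi * (a + 1) * exp (- a)) - - (2 * pi * (0 + 1) * exp (- 0)))"
      using assms
      by (intro nn_integral_FTC_Icc) (auto intro!: derivative_eq_intros simp: algebra_simps)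
    also have "- (2 * pi * (a + 1) * exp (- a)) - - (2 * pi * (0 + 1) * exp (- 0)) =
        2 * pi * (1 - (a + 1) * exp (- a))"
      by (simp add: algebra_simps)
    finally show ?thesis by (simp only: weighted_disc[OF assms])
  qed
  also have "\<dots> = ennreal (2 * pi * a * exp (- a) + 2 * pi * (1 - (a + 1) * exp (- a)))"
  proof (rule ennreal_plus [symmetric])
    have "(a + 1) * exp (- a) \<le> 1"
      using exp_ge_add_one_self[of a] by (simp add: exp_minus field_simps)
    then show "0 \<le> 2 * pi * (1 - (a + 1) * exp (- a))" by simp
  qed (use assms in simp)
  also have "2 * pi * a * exp (- a) + 2 * pi * (1 - (a + 1) * exp (- a)) = 2 * pi * (1 - exp (- a))"
    by (simp add: algebra_simps)
  finally show ?thesis .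
qed

text \<open>The joint density is \<open>exp (- |z|^2 / 2) / (2 * pi)\<close>, so the distribution
  function is the Gaussian mass of a disc. Half the squared modulus of a complex Gaussian coordinate
  is thus exponential, and sums of such terms are Erlang.\<close>

lemma (in prob_space) exponential_distributed_sum_squares_std_normal:
  assumes X: "distributed M lborel X std_normal_density"
    and Y: "distributed M lborel Y std_normal_density"
    and ind: "indep_var borel X borel Y"
  shows "distributed M lborel (\<lambda>\<omega>. ((X \<omega>)\<^sup>2 + (Y \<omega>)\<^sup>2) / 2) (exponential_density 1)"
proof (rule exponential_distributedI)
  have [measurable]: "random_variable borel X" "random_variable borel Y"
    using distributed_measurable[OF X] distributed_measurable[OF Y] by simp_all
  show "(\<lambda>\<omega>. ((X \<omega>)\<^sup>2 + (Y \<omega>)\<^sup>2) / 2) \<in> borel_measurable M" by measurable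
  fix a :: real assume a: "0 \<le> a"
  have "indep_var lborel X lborel Y"
    using ind by (simp add: indep_var_eq)
  then have "distributed M (lborel \<Otimes>\<^sub>M lborel) (\<lambda>\<omega>. (X \<omega>, Y \<omega>))
      (\<lambda>(x, y). ennreal (std_normal_density x) * ennreal (std_normal_density y))"
    by (intro distributed_joint_indep X Y) (auto intro: lborel.sigma_finite_measure_axioms)
  then have D: "distributed M lborel (\<lambda>\<omega>. (X \<omega>, Y \<omega>))
      (\<lambda>(x, y). ennreal (std_normal_density x) * ennreal (std_normal_density y))"
    by (simp add: lborel_prod)
  let ?A = "{z :: real \<times> real. (norm z)\<^sup>2 / 2 \<le> a}"
  have "emeasure M {\<omega>\<in>space M. ((X \<omega>)\<^sup>2 + (Y \<omega>)\<^sup>2) / 2 \<le> a} =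
      emeasure M ((\<lambda>\<omega>. (X \<omega>, Y \<omega>)) -` ?A \<inter> space M)"
    by (rule arg_cong[where f="emeasure M"]) (auto simp: norm_Pair)
  also have "\<dots> = (\<integral>\<^sup>+z. (case z of (x, y) \<Rightarrow>
      ennreal (std_normal_density x) * ennreal (std_normal_density y)) * indicator ?A z \<partial>lborel)"
    by (rule distributed_emeasure[OF D]) simp
  also have "\<dots> = (\<integral>\<^sup>+z. ennreal (1 / (2 * pi)) *
      ennreal (exp (- (norm z)\<^sup>2 / 2) * indicator ?A z) \<partial>lborel)"
  proof (intro nn_integral_cong, clarify)
    fix x y :: real
    have "std_normal_density x * std_normal_density y = 1 / (2 * pi) * exp (- (norm (x, y))\<^sup>2 / 2)"
      by (simp add: std_normal_density_def norm_Pair exp_add [symmetric] add_divide_distrib)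
    then show "ennreal (std_normal_density x) * ennreal (std_normal_density y) * indicator ?A (x, y) =
        ennreal (1 / (2 * pi)) * ennreal (exp (- (norm (x, y))\<^sup>2 / 2) * indicator ?A (x, y))"
      by (simp add: ennreal_mult [symmetric] split: split_indicator)
  qed
  also have "\<dots> = ennreal (1 / (2 * pi)) * ennreal (2 * pi * (1 - exp (- a)))"
    by (subst nn_integral_cmult, measurable) (simp only: nn_integral_gaussian_disc[OF a])
  also have "\<dots> = 1 - ennreal (exp (- a * 1))"
    using a by (simp add: ennreal_mult [symmetric] ennreal_minus [symmetric])
  finally show "emeasure M {\<omega>\<in>space M. ((X \<omega>)\<^sup>2 + (Y \<omega>)\<^sup>2) / 2 \<le> a} = 1 - ennreal (exp (- a * 1))" .
qed simp

text \<open>The density is \<open>x^n * exp (- x) / n!\<close> on \<open>x \<ge> 0\<close>, so the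
  factor \<open>sqrt x\<close> turns the integral into Euler's integral for
  \<open>Gamma (n + 3/2)\<close>, and \<open>n! = Gamma (n + 1)\<close>.\<close>

lemma nn_integral_sqrt_erlang:
  "(\<integral>\<^sup>+x. ennreal (erlang_density n 1 x) * ennreal (sqrt (2 * x)) \<partial>lborel) =
    ennreal (sqrt 2 * (Gamma (real (Suc n) + 1 / 2) / Gamma (real (Suc n))))"
proof -
  have "(\<integral>\<^sup>+x. ennreal (erlang_density n 1 x) * ennreal (sqrt (2 * x)) \<partial>lborel) =
      (\<integral>\<^sup>+t. ennreal (sqrt 2 / fact n) *
        ennreal (indicator {0..} t * t powr (real (Suc n) + 1 / 2 - 1) / exp t) \<partial>lborel)"
  proof (intro nn_integral_cong)
    fix x :: real
    \<comment> \<open>The \<open>powr\<close> laws need \<open>x > 0\<close>; at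
      \<open>x = 0\<close> both sides vanish, using \<open>0 powr a = 0\<close>.\<close>
    consider "x < 0" | "x = 0" | "0 < x" by linarith
    then show "ennreal (erlang_density n 1 x) * ennreal (sqrt (2 * x)) =
        ennreal (sqrt 2 / fact n) * ennreal (indicator {0..} x * x powr (real (Suc n) + 1 / 2 - 1) / exp x)"
    proof cases
      case 3
      then have "x powr (real (Suc n) + 1 / 2 - 1) = x ^ n * sqrt x"
        by (simp add: powr_add powr_realpow powr_half_sqrt)
      then show ?thesis using 3
        by (simp add: erlang_density_def ennreal_mult [symmetric] real_sqrt_mult exp_minus field_simps)
    qed (auto simp: erlang_density_def)
  qed
  also have "\<dots> = ennreal (sqrt 2 / fact n) * ennreal (Gamma (real (Suc n) + 1 / 2))"
    by (subst nn_integral_cmult) (auto simp: Gamma_conv_nn_integral_real)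
  also have "\<dots> = ennreal (sqrt 2 * (Gamma (real (Suc n) + 1 / 2) / Gamma (real (Suc n))))"
    by (simp add: ennreal_mult [symmetric] Gamma_fact [symmetric] add.commute)
  finally show ?thesis .
qed

text \<open>The two variables over each \<open>i\<close> are the real and imaginary part of a
  complex Gaussian. Half their square sums are independent exponentials, so the whole sum is twice
  an Erlang variable.\<close>

lemma (in prob_space) nn_integral_sqrt_sum_squares_indep_std_normal:
  fixes X :: "'i \<times> bool \<Rightarrow> 'a \<Rightarrow> real"
  assumes fin: "finite I" and ne: "I \<noteq> {}" and ind: "indep_vars (\<lambda>_. borel) X (I \<times> UNIV)"
    and X: "\<And>i. i \<in> I \<times> UNIV \<Longrightarrow> distributed M lborel (X i) std_normal_density"
  shows "(\<integral>\<^sup>+\<omega>. ennreal (sqrt (\<Sum>j\<in>I \<times> UNIV. (X j \<omega>)\<^sup>2)) \<partial>M) =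
    ennreal (sqrt 2 * (Gamma (real (card I) + 1 / 2) / Gamma (real (card I))))"
proof -
  define T where "T i \<omega> = ((X (i, False) \<omega>)\<^sup>2 + (X (i, True) \<omega>)\<^sup>2) / 2" for i \<omega>
  \<comment> \<open>Functions of disjoint blocks of independent variables are independent; the
    blocks are the pairs over each \<open>i\<close>.\<close>
  have "indep_vars (\<lambda>i. PiM ({i} \<times> UNIV) (\<lambda>_. borel)) (\<lambda>i \<omega>. restrict (\<lambda>j. X j \<omega>) ({i} \<times> UNIV)) I"
    by (rule indep_vars_restrict[OF ind]) (auto simp: disjoint_family_on_def)
  then have "indep_vars (\<lambda>_. borel)
      (\<lambda>i \<omega>. (\<lambda>f. ((f (i, False))\<^sup>2 + (f (i, True))\<^sup>2) / 2) (restrict (\<lambda>j. X j \<omega>) ({i} \<times> UNIV))) I"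
    by (rule indep_vars_compose2) measurable
  then have indT: "indep_vars (\<lambda>_. borel) T I"
    by (simp add: T_def [abs_def])
  have "distributed M lborel (T i) (exponential_density 1)" if "i \<in> I" for i
    unfolding T_def
  proof (rule exponential_distributed_sum_squares_std_normal)
    show "indep_var borel (X (i, False)) borel (X (i, True))"
      using that indep_var_compose[OF indep_var_restrict[OF ind, of "{(i, False)}" "{(i, True)}"],
          of "\<lambda>f. f (i, False)" borel "\<lambda>f. f (i, True)" borel]
      by (auto simp: comp_def)
  qed (use X that in auto)
  \<comment> \<open>The index of \<open>erlang_density\<close> is one less than the number of
    summands; \<open>I \<noteq> {}\<close> makes the subtraction exact.\<close>
  then have D: "distributed M lborel (\<lambda>\<omega>. \<Sum>i\<in>I. T i \<omega>) (erlang_density (card I - 1) 1)"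
    by (intro exponential_distributed_sum fin ne indT) auto
  have "2 * T i \<omega> = (\<Sum>b\<in>UNIV. (X (i, b) \<omega>)\<^sup>2)" for i \<omega>
    by (simp add: T_def UNIV_bool)
  then have "(\<Sum>j\<in>I \<times> UNIV. (X j \<omega>)\<^sup>2) = 2 * (\<Sum>i\<in>I. T i \<omega>)" for \<omega>
    by (simp add: sum.cartesian_product' sum_distrib_left)
  then have "(\<integral>\<^sup>+\<omega>. ennreal (sqrt (\<Sum>j\<in>I \<times> UNIV. (X j \<omega>)\<^sup>2)) \<partial>M) =
      (\<integral>\<^sup>+x. ennreal (erlang_density (card I - 1) 1 x) * ennreal (sqrt (2 * x)) \<partial>lborel)"
    by (subst distributed_nn_integral[OF D]) auto
  also have "\<dots> = ennreal (sqrt 2 * (Gamma (real (card I) + 1 / 2) / Gamma (real (card I))))"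
    using fin ne by (simp add: nn_integral_sqrt_erlang card_gt_0_iff)
  finally show ?thesis .
qed

subsection \<open>Averages over the Haar measure\<close>

lemma measurable_matrix_entry: "(\<lambda>U. U $ i $ j) \<in> borel_measurable (borel :: (complex^'n^'m) measure)"
  by (intro borel_measurable_continuous_onI continuous_intros)

lemma measurable_inner_matrix_vector:
  fixes d :: "complex^'n" and a :: "complex^'m"
  shows "(\<lambda>U. a \<bullet> (U *v d)) \<in> borel_measurable (borel :: (complex^'n^'m) measure)"
proof -
  note [measurable] = measurable_matrix_entry
  show ?thesis unfolding inner_vec_eq_Re matrix_vector_mult_def vec_lambda_beta by measurable
qed

text \<open>Preimages under multiplication by \<open>V\<close> are images under its inverse
  \<open>conj_transpose V\<close>, so invariance for images shows that the push-forward of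
  \<open>\<mu>\<close> is \<open>\<mu>\<close>.\<close>

lemma haar_nn_integral_left_mult:
  assumes "haar_prob_measure \<mu>" and V: "V \<in> unitary_group"
    and f: "f \<in> borel_measurable \<mu>"
  shows "(\<integral>\<^sup>+U. f (V ** U) \<partial>\<mu>) = (\<integral>\<^sup>+U. f U \<partial>\<mu>)"
proof -
  have space: "space \<mu> = unitary_group"
    and sets: "sets \<mu> = sets (restrict_space borel unitary_group)"
    and inv: "\<And>W A. W \<in> unitary_group \<Longrightarrow> A \<in> sets \<mu> \<Longrightarrow> emeasure \<mu> ((\<lambda>U. W ** U) ` A) = emeasure \<mu> A"
    using assms(1) by (auto simp: haar_prob_measure_def)
  let ?W = "conj_transpose V"
  have W: "?W \<in> unitary_group" "?W ** V = mat 1" "V ** ?W = mat 1"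
    using V unitary_group_conj_transpose by (auto simp: unitary_group_def)
  have "(\<lambda>U. V ** U) \<in> borel_measurable borel"
    unfolding matrix_matrix_mult_def
    by (intro borel_measurable_continuous_onI continuous_intros)
  then have meas: "(\<lambda>U. V ** U) \<in> measurable \<mu> \<mu>"
    unfolding measurable_cong_sets[OF sets sets]
    by (intro measurable_restrict_space3) (auto intro: unitary_group_mult V)
  have "distr \<mu> \<mu> (\<lambda>U. V ** U) = \<mu>"
  proof (rule measure_eqI)
    fix A assume "A \<in> sets (distr \<mu> \<mu> (\<lambda>U. V ** U))"
    then have A: "A \<in> sets \<mu>" by simp
    have "(\<lambda>U. V ** U) -` A \<inter> space \<mu> = (\<lambda>U. ?W ** U) ` A"
    proof (intro equalityI subsetI)
      fix U assume "U \<in> (\<lambda>U. V ** U) -` A \<inter> space \<mu>"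
      then have "V ** U \<in> A" by simp
      moreover have "U = ?W ** (V ** U)" by (simp add: matrix_mul_assoc W)
      ultimately show "U \<in> (\<lambda>U. ?W ** U) ` A" by blast
    next
      fix U assume "U \<in> (\<lambda>U. ?W ** U) ` A"
      then obtain U' where U': "U' \<in> A" "U = ?W ** U'" by auto
      have "V ** U = U'" by (simp add: U' matrix_mul_assoc W)
      moreover have "U \<in> space \<mu>"
        using U' A sets.sets_into_space[OF A] W(1) by (auto simp: space intro: unitary_group_mult)
      ultimately show "U \<in> (\<lambda>U. V ** U) -` A \<inter> space \<mu>" using U' by simp
    qed
    then show "emeasure (distr \<mu> \<mu> (\<lambda>U. V ** U)) A = emeasure \<mu> A"
      using A meas inv[OF W(1) A] by (simp add: emeasure_distr)
  qed simp
  then have "(\<integral>\<^sup>+U. f U \<partial>\<mu>) = (\<integral>\<^sup>+U. f U \<partial>(distr \<mu> \<mu> (\<lambda>U. V ** U)))" by simp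
  also have "\<dots> = (\<integral>\<^sup>+U. f (V ** U) \<partial>\<mu>)" by (rule nn_integral_distr[OF meas]) (simp add: f)
  finally show ?thesis by simp
qed

lemma haar_borel_measurable:
  assumes "haar_prob_measure \<mu>" "f \<in> borel_measurable borel"
  shows "f \<in> borel_measurable \<mu>"
proof -
  have sets: "sets \<mu> = sets (restrict_space borel unitary_group)"
    using assms(1) by (auto simp: haar_prob_measure_def)
  show ?thesis
    unfolding measurable_cong_sets[OF sets refl] by (rule measurable_restrict_space1[OF assms(2)])
qed

text \<open>Take a unitary \<open>V\<close> with \<open>V *v a = b\<close>; replacing
  \<open>U\<close> by \<open>conj_transpose V ** U\<close> turns \<open>a\<close> into
  \<open>b\<close>. Thus the law of \<open>a \<bullet> (U *v d)\<close> depends on \<open>a\<close>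
  only through its norm.\<close>

lemma haar_nn_integral_inner_eq:
  fixes a b d :: "complex^'n"
  assumes \<mu>: "haar_prob_measure \<mu>" and "norm a = norm b"
    and [measurable]: "h \<in> borel_measurable borel"
  shows "(\<integral>\<^sup>+U. h (a \<bullet> (U *v d)) \<partial>\<mu>) = (\<integral>\<^sup>+U. h (b \<bullet> (U *v d)) \<partial>\<mu>)"
proof -
  obtain V where V: "V \<in> unitary_group" "V *v a = b"
    using unitary_group_transitive[OF assms(2)] .
  have W: "conj_transpose V \<in> unitary_group"
    using V unitary_group_conj_transpose by blast
  note [measurable] = measurable_inner_matrix_vector
  have "a \<bullet> (conj_transpose V ** U *v d) = b \<bullet> (U *v d)" for U
    using inner_matrix_vector_conj_transpose[of a "conj_transpose V" "U *v d"] V(2)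
    by (simp add: matrix_vector_mul_assoc conj_transpose_def)
  moreover have "(\<lambda>U. h (a \<bullet> (U *v d))) \<in> borel_measurable \<mu>"
    by (intro haar_borel_measurable[OF \<mu>]) measurable
  ultimately show ?thesis using haar_nn_integral_left_mult[OF \<mu> W, of "\<lambda>U. h (a \<bullet> (U *v d))"] by simp
qed

text \<open>The flag \<open>True\<close> selects the imaginary part. This identifies complex vectors
  with real ones on the same index set as the Gaussian families.\<close>

definition coord :: "complex^'n \<Rightarrow> 'n \<times> bool \<Rightarrow> real" where
  "coord y j = (if snd j then Im (y $ fst j) else Re (y $ fst j))"

lemma sum_coord_squares:
  fixes y :: "complex^'n"
  assumes "finite I"
  shows "(\<Sum>j\<in>I \<times> UNIV. (coord y j)\<^sup>2) = (\<Sum>i\<in>I. (norm (y $ i))\<^sup>2)"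
  by (simp add: coord_def sum.cartesian_product' UNIV_bool cmod_power2 add.commute)

text \<open>An axis vector with entry \<open>1\<close> or \<open>\<i>\<close> works. Being unit test
  vectors, they give all real coordinates of \<open>U *v d\<close> the same law.\<close>

lemma coord_eq_inner:
  "\<exists>a. norm a = 1 \<and> (\<forall>y :: complex^'n. coord y j = a \<bullet> y)"
proof -
  define a :: "complex^'n" where "a = axis (fst j) (if snd j then \<i> else 1)"
  have "norm a = 1" by (simp add: a_def)
  moreover have "coord y j = a \<bullet> y" for y
    by (simp add: a_def coord_def inner_axis' inner_complex_def)
  ultimately show ?thesis by blast
qed

section \<open>Second moment of the norm of a block of coordinates of \<open>U *v d\<close>\<close>

lemma haar_measurable_coord:
  fixes d :: "complex^'n" and \<mu> :: "(complex^'n^'n) measure"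
  assumes "haar_prob_measure \<mu>"
  shows "(\<lambda>U. coord (U *v d) j) \<in> borel_measurable \<mu>"
proof -
  obtain a :: "complex^'n" where "\<forall>y. coord y j = a \<bullet> y"
    using coord_eq_inner[of j] by blast
  then show ?thesis
    using haar_borel_measurable[OF assms measurable_inner_matrix_vector[of a d]] by simp
qed

lemma haar_nn_integral_partial_norm_square:
  fixes d :: "complex^'n" and \<mu> :: "(complex^'n^'n) measure"
  assumes \<mu>: "haar_prob_measure \<mu>"
  shows "(\<integral>\<^sup>+U. ennreal (\<Sum>i\<in>I. (norm ((U *v d) $ i))\<^sup>2) \<partial>\<mu>) =
    ennreal ((norm d)\<^sup>2 * (real (card I) / real CARD('n)))"
proof -
  interpret prob_space \<mu> using \<mu> by (simp add: haar_prob_measure_def)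
  define a0 :: "complex^'n" where "a0 = axis undefined 1"
  define D where "D = (\<integral>\<^sup>+U. ennreal ((a0 \<bullet> (U *v d))\<^sup>2) \<partial>\<mu>)"
  note [measurable] = haar_measurable_coord[OF \<mu>]
  \<comment> \<open>All real coordinates share the second moment \<open>D\<close> of an arbitrary
    unit test vector, so a block of \<open>card J\<close> complex coordinates contributes
    \<open>2 * card J * D\<close>.\<close>
  have D: "(\<integral>\<^sup>+U. ennreal ((coord (U *v d) j)\<^sup>2) \<partial>\<mu>) = D" for j
  proof -
    obtain a where a: "norm a = 1" "\<forall>y :: complex^'n. coord y j = a \<bullet> y"
      using coord_eq_inner[of j] by blast
    have "norm a = norm a0" using a by (simp add: a0_def)
    from haar_nn_integral_inner_eq[OF \<mu> this, of "\<lambda>x. ennreal (x\<^sup>2)" d] show ?thesis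
      using a(2) by (simp add: D_def)
  qed
  have part: "(\<integral>\<^sup>+U. ennreal (\<Sum>i\<in>J. (norm ((U *v d) $ i))\<^sup>2) \<partial>\<mu>) = of_nat (2 * card J) * D" for J
  proof -
    have "(\<integral>\<^sup>+U. ennreal (\<Sum>i\<in>J. (norm ((U *v d) $ i))\<^sup>2) \<partial>\<mu>) =
        (\<integral>\<^sup>+U. (\<Sum>j\<in>J \<times> UNIV. ennreal ((coord (U *v d) j)\<^sup>2)) \<partial>\<mu>)"
      by (simp add: sum_coord_squares [symmetric] sum_ennreal)
    also have "\<dots> = (\<Sum>j\<in>J \<times> (UNIV :: bool set). D)"
      by (subst nn_integral_sum) (auto simp: D)
    finally show ?thesis by (simp add: card_cartesian_product mult.commute)
  qed
  have "(\<Sum>i\<in>UNIV. (norm ((U *v d) $ i))\<^sup>2) = (norm d)\<^sup>2" if "U \<in> space \<mu>" for U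
  proof -
    have "(\<Sum>i\<in>UNIV. (norm ((U *v d) $ i))\<^sup>2) = (norm (U *v d))\<^sup>2"
      by (simp add: norm_vec_def L2_set_def sum_nonneg)
    then show ?thesis
      using that \<mu> norm_unitary_mult[of U d] by (simp add: haar_prob_measure_def)
  qed
  then have "(\<integral>\<^sup>+U. ennreal (\<Sum>i\<in>UNIV. (norm ((U *v d) $ i))\<^sup>2) \<partial>\<mu>) = (\<integral>\<^sup>+U. ennreal ((norm d)\<^sup>2) \<partial>\<mu>)"
    by (intro nn_integral_cong) simp
  \<comment> \<open>Over all coordinates the norm is \<open>norm d\<close> by unitarity; this
    determines \<open>D\<close> and rules out \<open>\<top>\<close>.\<close>
  then have full: "of_nat (2 * CARD('n)) * D = ennreal ((norm d)\<^sup>2)"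
    by (simp add: part emeasure_space_1)
  have "D \<noteq> \<top>"
  proof
    assume "D = \<top>"
    then show False using full by (simp add: ennreal_mult_top)
  qed
  then obtain x where x: "0 \<le> x" "D = ennreal x" by (cases D) auto
  have "2 * real CARD('n) * x = (norm d)\<^sup>2"
  proof -
    have "ennreal (real (2 * CARD('n)) * x) = ennreal ((norm d)\<^sup>2)"
      using full x by (simp add: ennreal_mult flip: ennreal_of_nat_eq_real_of_nat)
    then show ?thesis using x by simp
  qed
  then have "real (2 * card I) * x = (norm d)\<^sup>2 * (real (card I) / real CARD('n))"
    by (simp add: field_simps)
  then show ?thesis
    using x by (simp add: part ennreal_of_nat_eq_real_of_nat ennreal_mult [symmetric] del: of_nat_mult)
qed

section \<open>Gaussian test vectors and the first moment of the norm of a block of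
  coordinates\<close>

lemma indep_vars_PiM_std_normal:
  assumes "finite I" "I \<noteq> {}"
  defines "M \<equiv> PiM I (\<lambda>_. density lborel std_normal_density)"
  shows "prob_space M"
    and "prob_space.indep_vars M (\<lambda>_. borel) (\<lambda>j \<omega>. \<omega> j) I"
    and "j \<in> I \<Longrightarrow> distributed M lborel (\<lambda>\<omega>. \<omega> j) std_normal_density"
proof -
  let ?G = "density lborel std_normal_density"
  have G: "prob_space ?G" by (rule prob_space_normal_density) simp
  show M: "prob_space M" unfolding M_def by (intro prob_space_PiM G)
  interpret prob_space M by fact
  have comp: "distr M borel (\<lambda>\<omega>. \<omega> j) = ?G" if "j \<in> I" for j
  proof -
    have "distr M borel (\<lambda>\<omega>. \<omega> j) = distr M ?G (\<lambda>\<omega>. \<omega> j)" by (rule distr_cong) auto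
    also have "\<dots> = ?G" unfolding M_def by (rule distr_PiM_component) (use G that in auto)
    finally show ?thesis .
  qed
  have rv: "(\<lambda>\<omega>. \<omega> j) \<in> borel_measurable M" if "j \<in> I" for j
  proof -
    have "(\<lambda>\<omega>. \<omega> j) \<in> measurable M ?G"
      unfolding M_def using that by (rule measurable_component_singleton)
    then show ?thesis by simp
  qed
  show "indep_vars (\<lambda>_. borel) (\<lambda>j \<omega>. \<omega> j) I"
  proof (subst indep_vars_iff_distr_eq_PiM')
    \<comment> \<open>The joint law of the projections is that of the identity map, hence the
      product measure itself; this is the criterion for independence.\<close>
    have "distr M (PiM I (\<lambda>_. borel)) (\<lambda>\<omega>. \<lambda>i\<in>I. \<omega> i) = distr M M (\<lambda>\<omega>. \<omega>)"
    proof (rule distr_cong)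
      show "sets (PiM I (\<lambda>_. borel)) = sets M" unfolding M_def by (rule sets_PiM_cong) auto
    qed (auto simp: M_def space_PiM restrict_PiE_iff PiE_restrict)
    also have "\<dots> = M" by simp
    also have "\<dots> = PiM I (\<lambda>i. distr M borel (\<lambda>\<omega>. \<omega> i))"
      unfolding M_def by (rule PiM_cong) (auto simp: comp[unfolded M_def])
    finally show "distr M (PiM I (\<lambda>_. borel)) (\<lambda>\<omega>. \<lambda>i\<in>I. \<omega> i) = PiM I (\<lambda>i. distr M borel (\<lambda>\<omega>. \<omega> i))" .
  qed (use assms rv in auto)
  show "distributed M lborel (\<lambda>\<omega>. \<omega> j) std_normal_density" if "j \<in> I"
  proof -
    have "distr M lborel (\<lambda>\<omega>. \<omega> j) = distr M borel (\<lambda>\<omega>. \<omega> j)" by (rule distr_cong) auto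
    then show ?thesis using comp[OF that] rv[OF that] by (simp add: distributed_def)
  qed
qed

text \<open>The vector \<open>norm a *\<^sub>R b\<close> has the same norm as \<open>a\<close>, so
  it may replace \<open>a\<close>, and the absolute value is homogeneous.\<close>

lemma haar_nn_integral_abs_inner:
  fixes a b d :: "complex^'n"
  assumes \<mu>: "haar_prob_measure \<mu>" and b: "norm b = 1"
  shows "(\<integral>\<^sup>+U. ennreal \<bar>a \<bullet> (U *v d)\<bar> \<partial>\<mu>) = ennreal (norm a) * (\<integral>\<^sup>+U. ennreal \<bar>b \<bullet> (U *v d)\<bar> \<partial>\<mu>)"
proof -
  have [measurable]: "(\<lambda>U. b \<bullet> (U *v d)) \<in> borel_measurable \<mu>"
    by (rule haar_borel_measurable[OF \<mu> measurable_inner_matrix_vector])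
  have "(\<integral>\<^sup>+U. ennreal \<bar>a \<bullet> (U *v d)\<bar> \<partial>\<mu>) = (\<integral>\<^sup>+U. ennreal \<bar>(norm a *\<^sub>R b) \<bullet> (U *v d)\<bar> \<partial>\<mu>)"
    using b by (intro haar_nn_integral_inner_eq[OF \<mu>, where h="\<lambda>x. ennreal \<bar>x\<bar>"]) auto
  also have "\<dots> = (\<integral>\<^sup>+U. ennreal (norm a) * ennreal \<bar>b \<bullet> (U *v d)\<bar> \<partial>\<mu>)"
    by (simp add: abs_mult ennreal_mult)
  also have "\<dots> = ennreal (norm a) * (\<integral>\<^sup>+U. ennreal \<bar>b \<bullet> (U *v d)\<bar> \<partial>\<mu>)"
    by (rule nn_integral_cmult) measurable
  finally show ?thesis .
qed

text \<open>The mean of \<open>|a \<bullet> U d|\<close> over \<open>U\<close> and a Gaussian vector \<open>a\<close> supported on the coordinates in \<open>I\<close>,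
  computed in both orders.\<close>
lemma haar_nn_integral_partial_norm_gaussian:
  fixes b d :: "complex^'n"
  assumes \<mu>: "haar_prob_measure \<mu>" and b: "norm b = 1" and I: "I \<noteq> {}"
  shows "ennreal (sqrt (2 / pi)) * (\<integral>\<^sup>+U. ennreal (sqrt (\<Sum>i\<in>I. (norm ((U *v d) $ i))\<^sup>2)) \<partial>\<mu>) =
    ennreal (sqrt 2 * (Gamma (real (card I) + 1 / 2) / Gamma (real (card I)))) *
      (\<integral>\<^sup>+U. ennreal \<bar>b \<bullet> (U *v d)\<bar> \<partial>\<mu>)"
proof -
  define M where "M = PiM (UNIV :: ('n \<times> bool) set) (\<lambda>_. density lborel std_normal_density)"
  note M = indep_vars_PiM_std_normal[of "UNIV :: ('n \<times> bool) set", folded M_def, simplified]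
  interpret M: prob_space M by (rule M(1))
  interpret H: prob_space \<mu> using \<mu> by (simp add: haar_prob_measure_def)
  interpret pair_sigma_finite \<mu> M ..
  let ?C = "\<integral>\<^sup>+U. ennreal \<bar>b \<bullet> (U *v d)\<bar> \<partial>\<mu>"
  have [measurable]: "(\<lambda>\<omega>. \<omega> j) \<in> borel_measurable M" for j
    using distributed_measurable[OF M(3)] by simp
  note [measurable] = haar_measurable_coord[OF \<mu>]
  have ind: "M.indep_vars (\<lambda>_. borel) (\<lambda>j \<omega>. \<omega> j) (I \<times> UNIV)"
    by (rule M.indep_vars_subset[OF M(2)]) simp
  define a :: "('n \<times> bool \<Rightarrow> real) \<Rightarrow> complex^'n" where
    "a \<omega> = (\<chi> i. if i \<in> I then Complex (\<omega> (i, False)) (\<omega> (i, True)) else 0)" for \<omega>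
  have inner: "a \<omega> \<bullet> y = (\<Sum>j\<in>I \<times> UNIV. coord y j * \<omega> j)" for \<omega> y
  proof -
    have "a \<omega> \<bullet> y = (\<Sum>i\<in>I. Complex (\<omega> (i, False)) (\<omega> (i, True)) \<bullet> y $ i)"
      unfolding inner_vec_def a_def by (intro sum.mono_neutral_cong_right) auto
    then show ?thesis
      by (simp add: sum.cartesian_product' UNIV_bool coord_def inner_complex_def ac_simps)
  qed
  have norm: "norm (a \<omega>) = sqrt (\<Sum>j\<in>I \<times> UNIV. (\<omega> j)\<^sup>2)" for \<omega>
  proof -
    have "(\<Sum>i\<in>UNIV. (norm (a \<omega> $ i))\<^sup>2) = (\<Sum>i\<in>I. (norm (Complex (\<omega> (i, False)) (\<omega> (i, True))))\<^sup>2)"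
      unfolding a_def by (intro sum.mono_neutral_cong_right) auto
    then show ?thesis
      by (simp add: norm_vec_def L2_set_def cmod_power2 sum.cartesian_product' UNIV_bool add.commute)
  qed
  \<comment> \<open>Averaging over \<open>U\<close> first leaves \<open>norm (a \<omega>)\<close>
    times a constant, and then the mean norm of a complex Gaussian vector.\<close>
  have "(\<integral>\<^sup>+\<omega>. (\<integral>\<^sup>+U. ennreal \<bar>a \<omega> \<bullet> (U *v d)\<bar> \<partial>\<mu>) \<partial>M) = (\<integral>\<^sup>+\<omega>. ennreal (norm (a \<omega>)) * ?C \<partial>M)"
    by (intro nn_integral_cong haar_nn_integral_abs_inner[OF \<mu> b])
  also have "\<dots> = (\<integral>\<^sup>+\<omega>. ennreal (norm (a \<omega>)) \<partial>M) * ?C"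
    unfolding norm by (rule nn_integral_multc) measurable
  also have "(\<integral>\<^sup>+\<omega>. ennreal (norm (a \<omega>)) \<partial>M) =
      ennreal (sqrt 2 * (Gamma (real (card I) + 1 / 2) / Gamma (real (card I))))"
    unfolding norm by (rule M.nn_integral_sqrt_sum_squares_indep_std_normal[OF _ I ind]) (auto intro: M(3))
  finally have 1: "(\<integral>\<^sup>+\<omega>. (\<integral>\<^sup>+U. ennreal \<bar>a \<omega> \<bullet> (U *v d)\<bar> \<partial>\<mu>) \<partial>M) =
      ennreal (sqrt 2 * (Gamma (real (card I) + 1 / 2) / Gamma (real (card I)))) * ?C" .
  \<comment> \<open>In the other order \<open>y = U *v d\<close> is fixed, and
    \<open>a \<omega> \<bullet> y\<close> is a combination of Gaussians whose coefficients are the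
    coordinates of \<open>y\<close> over \<open>I\<close>.\<close>
  have "(\<integral>\<^sup>+\<omega>. ennreal \<bar>a \<omega> \<bullet> y\<bar> \<partial>M) = ennreal (sqrt (2 / pi)) * ennreal (sqrt (\<Sum>i\<in>I. (norm (y $ i))\<^sup>2))" for y
  proof -
    have "(\<integral>\<^sup>+\<omega>. ennreal \<bar>a \<omega> \<bullet> y\<bar> \<partial>M) = ennreal (sqrt (2 / pi) * sqrt (\<Sum>j\<in>I \<times> UNIV. (coord y j)\<^sup>2))"
      unfolding inner by (rule M.nn_integral_abs_sum_indep_std_normal[OF _ ind]) (auto intro: M(3))
    then show ?thesis by (simp add: sum_coord_squares ennreal_mult sum_nonneg)
  qed
  then have "(\<integral>\<^sup>+U. (\<integral>\<^sup>+\<omega>. ennreal \<bar>a \<omega> \<bullet> (U *v d)\<bar> \<partial>M) \<partial>\<mu>) =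
      (\<integral>\<^sup>+U. ennreal (sqrt (2 / pi)) * ennreal (sqrt (\<Sum>i\<in>I. (norm ((U *v d) $ i))\<^sup>2)) \<partial>\<mu>)"
    by simp
  also have "\<dots> = ennreal (sqrt (2 / pi)) * (\<integral>\<^sup>+U. ennreal (sqrt (\<Sum>i\<in>I. (norm ((U *v d) $ i))\<^sup>2)) \<partial>\<mu>)"
    unfolding sum_coord_squares[OF finite, symmetric] by (rule nn_integral_cmult) measurable
  also have "(\<integral>\<^sup>+U. (\<integral>\<^sup>+\<omega>. ennreal \<bar>a \<omega> \<bullet> (U *v d)\<bar> \<partial>M) \<partial>\<mu>) =
      (\<integral>\<^sup>+\<omega>. (\<integral>\<^sup>+U. ennreal \<bar>a \<omega> \<bullet> (U *v d)\<bar> \<partial>\<mu>) \<partial>M)"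
    unfolding inner by (rule Fubini'[symmetric]) measurable
  finally show ?thesis using 1 by simp
qed

text \<open>The Gaussian identity is used twice with the same constant \<open>C\<close>: for all
  coordinates, where the norm is \<open>norm d\<close>, it determines \<open>C\<close>; for
  \<open>I\<close> it then gives the mean.\<close>

lemma haar_nn_integral_partial_norm:
  fixes d :: "complex^'n" and \<mu> :: "(complex^'n^'n) measure"
  assumes \<mu>: "haar_prob_measure \<mu>" and I: "I \<noteq> {}"
  defines "g \<equiv> \<lambda>n. Gamma (real n + 1 / 2) / Gamma (real n)"
  shows "(\<integral>\<^sup>+U. ennreal (sqrt (\<Sum>i\<in>I. (norm ((U *v d) $ i))\<^sup>2)) \<partial>\<mu>) =
    ennreal (norm d * (g (card I) / g CARD('n)))"
proof -
  interpret prob_space \<mu> using \<mu> by (simp add: haar_prob_measure_def)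
  define b :: "complex^'n" where "b = axis undefined 1"
  have b: "norm b = 1" by (simp add: b_def)
  define C where "C = (\<integral>\<^sup>+U. ennreal \<bar>b \<bullet> (U *v d)\<bar> \<partial>\<mu>)"
  have gpos: "0 < g n" if "0 < n" for n
    unfolding g_def using that by (auto intro!: divide_pos_pos Gamma_real_pos)
  note * = haar_nn_integral_partial_norm_gaussian[OF \<mu> b, where d=d, folded C_def]
  have "sqrt (\<Sum>i\<in>UNIV. (norm ((U *v d) $ i))\<^sup>2) = norm d" if "U \<in> space \<mu>" for U
  proof -
    have "sqrt (\<Sum>i\<in>UNIV. (norm ((U *v d) $ i))\<^sup>2) = norm (U *v d)"
      by (simp add: norm_vec_def L2_set_def)
    then show ?thesis
      using that \<mu> norm_unitary_mult[of U d] by (simp add: haar_prob_measure_def)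
  qed
  then have "(\<integral>\<^sup>+U. ennreal (sqrt (\<Sum>i\<in>UNIV. (norm ((U *v d) $ i))\<^sup>2)) \<partial>\<mu>) = (\<integral>\<^sup>+U. ennreal (norm d) \<partial>\<mu>)"
    by (intro nn_integral_cong) simp
  then have full: "ennreal (sqrt 2 * g CARD('n)) * C = ennreal (sqrt (2 / pi) * norm d)"
    using *[of UNIV] by (simp add: emeasure_space_1 ennreal_mult g_def)
  have gN: "0 < g CARD('n)" and gI: "0 < g (card I)"
    using I by (auto intro!: gpos simp: card_gt_0_iff)
  have "C \<noteq> \<top>"
  proof
    assume "C = \<top>"
    then show False using full gN by (simp add: ennreal_mult_top)
  qed
  then obtain c where c: "0 \<le> c" "C = ennreal c" by (cases C) auto
  have c_eq: "sqrt 2 * g CARD('n) * c = sqrt (2 / pi) * norm d"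
    using full c gN by (simp add: ennreal_mult [symmetric])
  let ?J = "\<integral>\<^sup>+U. ennreal (sqrt (\<Sum>i\<in>I. (norm ((U *v d) $ i))\<^sup>2)) \<partial>\<mu>"
  have part: "ennreal (sqrt (2 / pi)) * ?J = ennreal (sqrt 2 * g (card I) * c)"
    using *[OF I] c gI by (simp add: g_def ennreal_mult'' [symmetric])
  have "?J \<noteq> \<top>"
  proof
    assume "?J = \<top>"
    then show False using part by (simp add: ennreal_mult_top)
  qed
  then obtain x where x: "0 \<le> x" "?J = ennreal x" by (cases ?J) auto
  have "sqrt (2 / pi) * x = sqrt 2 * g (card I) * c"
    using part x c gI by (simp add: ennreal_mult [symmetric])
  then have "sqrt (2 / pi) * x * g CARD('n) = (sqrt 2 * g CARD('n) * c) * g (card I)" by simp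
  also have "\<dots> = sqrt (2 / pi) * norm d * g (card I)" by (simp only: c_eq)
  finally have "x = norm d * (g (card I) / g CARD('n))"
    using gN by (simp add: field_simps)
  then show ?thesis using x by simp
qed

section \<open>Markov bound for the squared deviation, and the conclusion\<close>

lemma (in prob_space) second_moment_deviation:
  fixes Z :: "'a \<Rightarrow> real"
  assumes [measurable]: "Z \<in> borel_measurable M" and nonneg: "\<And>x. 0 \<le> Z x" and "0 \<le> m" "0 \<le> q"
    and m: "(\<integral>\<^sup>+x. ennreal (Z x) \<partial>M) = ennreal m"
    and q: "(\<integral>\<^sup>+x. ennreal ((Z x)\<^sup>2) \<partial>M) = ennreal q"
    and t: "0 < t"
  shows "1 - (q - 2 * R * m + R\<^sup>2) / t\<^sup>2 \<le> prob {x \<in> space M. \<bar>Z x - R\<bar> \<le> t}"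
proof -
  have Z: "has_bochner_integral M Z m"
    by (rule has_bochner_integral_nn_integral) (use assms in auto)
  have Z2: "has_bochner_integral M (\<lambda>x. (Z x)\<^sup>2) q"
    by (rule has_bochner_integral_nn_integral) (use assms in auto)
  have eq: "(Z x - R)\<^sup>2 = (Z x)\<^sup>2 - 2 * R * Z x + R\<^sup>2" for x
    by (simp add: power2_eq_square algebra_simps)
  have int: "integrable M (\<lambda>x. (Z x - R)\<^sup>2)"
    unfolding eq using Z Z2 by (auto simp: has_bochner_integral_iff)
  have E: "expectation (\<lambda>x. (Z x - R)\<^sup>2) = q - 2 * R * m + R\<^sup>2"
    unfolding eq using Z Z2 by (simp add: has_bochner_integral_iff prob_space)
  \<comment> \<open>The strict event \<open>|Z - R| > t\<close> is enlarged to the closed one for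
    Markov's inequality.\<close>
  have "prob {x \<in> space M. \<not> \<bar>Z x - R\<bar> \<le> t} \<le> prob {x \<in> space M. t\<^sup>2 \<le> (Z x - R)\<^sup>2}"
  proof (rule finite_measure_mono)
    have "t\<^sup>2 \<le> y\<^sup>2" if "\<not> \<bar>y\<bar> \<le> t" for y
      using that t power_mono[of t "\<bar>y\<bar>" 2] by simp
    then show "{x \<in> space M. \<not> \<bar>Z x - R\<bar> \<le> t} \<subseteq> {x \<in> space M. t\<^sup>2 \<le> (Z x - R)\<^sup>2}" by blast
  qed measurable
  also have "\<dots> \<le> (q - 2 * R * m + R\<^sup>2) / t\<^sup>2"
    using integral_Markov_inequality_measure[OF int, of "space M" "t\<^sup>2"] t by (simp add: E)
  finally have "prob {x \<in> space M. \<not> \<bar>Z x - R\<bar> \<le> t} \<le> (q - 2 * R * m + R\<^sup>2) / t\<^sup>2" .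
  moreover have "prob {x \<in> space M. \<not> \<bar>Z x - R\<bar> \<le> t} = 1 - prob {x \<in> space M. \<bar>Z x - R\<bar> \<le> t}"
    by (rule prob_neg) measurable
  ultimately show ?thesis by simp
qed

theorem mainTheorem1:
  fixes N k :: nat
    and \<epsilon> :: real
    and x1 x2 :: "real^'n"
    and r :: "'k::finite \<Rightarrow> 'n::finite"
    and \<mu>\<^sub>H :: "(complex^'n^'n) measure"
  assumes "CARD('n) = N" and "CARD('k) = k"
    and "1 \<le> k" and "k \<le> N"
    and "\<epsilon> > 0"
    and "inj r"
    and "haar_prob_measure \<mu>\<^sub>H"
  shows "measure \<mu>\<^sub>H {U \<in> space \<mu>\<^sub>H.
           (1 - \<epsilon>) * norm (x1 - x2) \<le> norm (scaled_rows r U *v complex_vec (x1 - x2)) \<and>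
           norm (scaled_rows r U *v complex_vec (x1 - x2)) \<le> (1 + \<epsilon>) * norm (x1 - x2)}
         \<ge> 1 - (real N - real k) / (4 * real k * real N * \<epsilon>\<^sup>2)"
proof -
  note \<mu> = assms(7)
  interpret prob_space \<mu>\<^sub>H using \<mu> by (simp add: haar_prob_measure_def)
  define d :: "complex^'n" where "d = complex_vec (x1 - x2)"
  define R where "R = norm (x1 - x2)"
  define s where "s = sqrt (real N / real k)"
  define S where "S U = sqrt (\<Sum>i\<in>range r. (norm ((U *v d) $ i))\<^sup>2)" for U :: "complex^'n^'n"
  define Z where "Z U = norm (scaled_rows r U *v d)" for U
  have Nk: "0 < real k" "real k \<le> real N" using assms by auto
  have "norm (complex_vec x) = norm x" for x :: "real^'n"
    by (simp add: complex_vec_def norm_vec_def)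
  then have norm_d: "norm d = R"
    by (simp add: d_def R_def)
  have card: "card (range r) = k" using assms by (simp add: card_image)
  \<comment> \<open>Injectivity of \<open>r\<close> turns the sum over the chosen rows into a sum
    over the set \<open>range r\<close>, the form needed for the moment lemmas.\<close>
  have Z_eq: "Z U = s * S U" for U
  proof -
    have "scaled_rows r U *v d = s *\<^sub>R (\<chi> i. (U *v d) $ r i)"
      using assms by (simp add: scaled_rows_def s_def row_def matrix_vector_mult_def vec_eq_iff
          scaleR_sum_right)
    moreover have "norm (\<chi> i. (U *v d) $ r i) = S U"
      using \<open>inj r\<close> by (simp add: S_def norm_vec_def L2_set_def sum.reindex)
    ultimately show ?thesis by (simp add: Z_def s_def)
  qed
  note [measurable] = haar_measurable_coord[OF \<mu>]
  have [measurable]: "S \<in> borel_measurable \<mu>\<^sub>H"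
    unfolding S_def sum_coord_squares[OF finite, symmetric] by measurable
  have [measurable]: "Z \<in> borel_measurable \<mu>\<^sub>H"
    unfolding Z_eq by measurable
  define g where "g n = Gamma (real n + 1 / 2) / Gamma (real n)" for n
  \<comment> \<open>The mean of \<open>Z\<close> is \<open>R * \<beta>\<close>.\<close>
  define \<beta> where "\<beta> = s * (g k / g N)"
  have gpos: "0 < g k" "0 < g N"
    unfolding g_def using Nk by (auto intro!: divide_pos_pos Gamma_real_pos)
  have "\<integral>\<^sup>+U. ennreal (S U) \<partial>\<mu>\<^sub>H = ennreal (R * (g k / g N))"
    using haar_nn_integral_partial_norm[OF \<mu>, where I="range r" and d=d] assms(1)
    by (simp add: S_def g_def norm_d card)
  then have mean: "(\<integral>\<^sup>+U. ennreal (Z U) \<partial>\<mu>\<^sub>H) = ennreal (R * \<beta>)"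
    unfolding Z_eq using gpos
    by (simp add: s_def ennreal_mult' nn_integral_cmult \<beta>_def R_def flip: ennreal_mult)
  have "\<integral>\<^sup>+U. ennreal ((S U)\<^sup>2) \<partial>\<mu>\<^sub>H = ennreal (R\<^sup>2 * (k / N))"
    using haar_nn_integral_partial_norm_square[OF \<mu>, where I="range r" and d=d] assms(1)
    by (simp add: S_def norm_d card sum_nonneg)
  moreover have "(\<integral>\<^sup>+U. ennreal ((Z U)\<^sup>2) \<partial>\<mu>\<^sub>H) = ennreal (s\<^sup>2) * (\<integral>\<^sup>+U. ennreal ((S U)\<^sup>2) \<partial>\<mu>\<^sub>H)"
    unfolding Z_eq power_mult_distrib by (simp add: ennreal_mult nn_integral_cmult)
  \<comment> \<open>The scaling \<open>sqrt (N / k)\<close> is what makes the mean of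
    \<open>Z^2\<close> equal to \<open>R^2\<close>.\<close>
  moreover have "s\<^sup>2 * (R\<^sup>2 * (k / N)) = R\<^sup>2"
    using Nk by (simp add: s_def)
  ultimately have square: "(\<integral>\<^sup>+U. ennreal ((Z U)\<^sup>2) \<partial>\<mu>\<^sub>H) = ennreal (R\<^sup>2)"
    by (metis ennreal_mult' zero_le_power2)
  have \<beta>: "1 - (1 / real k - 1 / real N) / 8 \<le> \<beta>"
  proof -
    have "(1 - (1 / real k - 1 / real N) / 8) * (g N / sqrt N) \<le> g k / sqrt k"
      using Gamma_half_quotient_ratio[of k N] assms by (simp add: g_def)
    then show ?thesis
      using gpos Nk by (simp add: \<beta>_def s_def real_sqrt_divide field_simps)
  qed
  show ?thesis
  proof (cases "R = 0")
    case True
    then have "S U = 0" if "U \<in> space \<mu>\<^sub>H" for U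
      using norm_d by (simp add: S_def)
    then have "{U \<in> space \<mu>\<^sub>H. (1 - \<epsilon>) * R \<le> Z U \<and> Z U \<le> (1 + \<epsilon>) * R} = space \<mu>\<^sub>H"
      using True by (auto simp: Z_eq)
    then show ?thesis
      using Nk by (simp add: prob_space R_def Z_def d_def)
  next
    case False
    then have R: "0 < R" by (simp add: R_def)
    \<comment> \<open>With threshold \<open>\<epsilon> * R\<close> the bound is
      \<open>2 * (1 - \<beta>) / \<epsilon>^2\<close>. The constant \<open>1/4\<close> is this
      factor \<open>2\<close> times the \<open>1/8\<close> in the bound on
      \<open>\<beta>\<close>.\<close>
    have "(R\<^sup>2 - 2 * R * (R * \<beta>) + R\<^sup>2) / (\<epsilon> * R)\<^sup>2 = 2 * (1 - \<beta>) / \<epsilon>\<^sup>2"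
      using R assms(5) by (simp add: field_simps power2_eq_square)
    also have "\<dots> \<le> (1 / real k - 1 / real N) / 4 / \<epsilon>\<^sup>2"
    proof (rule divide_right_mono)
      have "2 * (1 - y) \<le> p / 4" if "1 - p / 8 \<le> y" for p y :: real
        using that by simp
      then show "2 * (1 - \<beta>) \<le> (1 / real k - 1 / real N) / 4" using \<beta> by blast
    qed simp
    also have "\<dots> = (real N - real k) / (4 * real k * real N * \<epsilon>\<^sup>2)"
      using Nk by (simp add: field_simps)
    finally have "1 - (real N - real k) / (4 * real k * real N * \<epsilon>\<^sup>2) \<le>
        1 - (R\<^sup>2 - 2 * R * (R * \<beta>) + R\<^sup>2) / (\<epsilon> * R)\<^sup>2" by simp
    also have "\<dots> \<le> prob {U \<in> space \<mu>\<^sub>H. \<bar>Z U - R\<bar> \<le> \<epsilon> * R}"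
    proof (rule second_moment_deviation[OF _ _ _ _ mean square])
      show "0 \<le> R * \<beta>" using R gpos by (simp add: \<beta>_def s_def)
    qed (use R assms(5) in \<open>auto simp: Z_def [abs_def, symmetric]\<close>, simp add: Z_def)
    also have "{U \<in> space \<mu>\<^sub>H. \<bar>Z U - R\<bar> \<le> \<epsilon> * R} =
        {U \<in> space \<mu>\<^sub>H. (1 - \<epsilon>) * R \<le> Z U \<and> Z U \<le> (1 + \<epsilon>) * R}"
      by (auto simp: abs_le_iff algebra_simps)
    finally show ?thesis by (simp add: R_def Z_def d_def)
  qed
qed

end
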